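(* Let $\phi\in\mathsf{SIF}$ be a simple inequality formula. Then $\phi$ is $\mathsf{QP}$ valid if and only if $\phi^\triangle$ is $\mathsf{QPG}$ valid.
   Context: $\mathscr{L}_{\mathsf{CPL}}$ is the set of classical propositional formulas over a countable set $\mathtt{Prop}$ of variables. $\mathsf{QP}$: the language is $\phi::=p\in\mathtt{Prop}\mid{\sim}\phi\mid(\phi\wedge\phi)\mid(\phi\lesssim\phi)$, with $\vee$, $\supset$ the usual classical abbreviations. A G\"ardenfors probabilistic frame is $\langle U,\{\mathtt{P}_x\}_{x\in U}\rangle$ with $U\ne\varnothing$ and each $\mathtt{P}_x$ a probability measure on $2^U$; a G\"ardenfors model adds $v:\mathtt{Prop}\to2^U$, extended by $\|p\|=v(p)$, $\|{\sim}\phi\|=U\setminus\|\phi\|$, $\|\phi\wedge\psi\|=\|\phi\|\cap\|\psi\|$, $\|\phi\lesssim\psi\|=\{x\in U:\mathtt{P}_x(\|\phi\|)\leq\mathtt{P}_x(\|\psi\|)\}$. A formula $\phi$ is true in a model if $\|\phi\|=U$, and $\mathsf{QP}$ valid if it is true in every G\"ardenfors model. Simple inequality formulas $\mathsf{SIF}$: $\phi::=\chi\lesssim\chi'\mid{\sim}\phi\mid(\phi\wedge\phi)\mid(\phi\vee\phi)\mid(\phi\supset\phi)$, where $\chi,\chi'$ do not contain $\lesssim$ (i.e. $\chi,\chi'\in\mathscr{L}_{\mathsf{CPL}}$). Bi-G\"odel operations on $[0,1]$: $\wedge=\min$, $\vee=\max$; $a\rightarrow b=1$ if $a\leq b$ and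 $b$ otherwise; co-implication $a\prec b=0$ if $a\leq b$ and $a$ otherwise; ${\sim}a=1$ if $a=0$ and $0$ otherwise; $\triangle a=1$ if $a=1$ and $0$ otherwise ($\triangle$ is definable via $\prec$). $\mathscr{L}_{\mathsf{QG}}$: $\alpha::=\mathtt{B}\chi\mid{\sim}\alpha\mid(\alpha\wedge\alpha)\mid(\alpha\vee\alpha)\mid(\alpha\rightarrow\alpha)\mid(\alpha\prec\alpha)$ with $\chi\in\mathscr{L}_{\mathsf{CPL}}$. Translation $^\triangle:\mathsf{SIF}\to\mathscr{L}_{\mathsf{QG}}$: $(\chi\lesssim\chi')^\triangle=\triangle(\mathtt{B}\chi\rightarrow\mathtt{B}\chi')$; $({\sim}\phi)^\triangle={\sim}\phi^\triangle$; $(\phi\circ\phi')^\triangle=\phi^\triangle\circ\phi'^\triangle$ for $\circ\in\{\wedge,\vee\}$; $(\phi\supset\phi')^\triangle=\phi^\triangle\rightarrow\phi'^\triangle$. An uncertainty measure on $W\neq\varnothing$ is $\mu:2^W\to[0,1]$ with $\mu(X)\leq\mu(Y)$ whenever $X\subseteq Y$, and $\mu(W)>\mu(\varnothing)$. A $\mathsf{QG}$ model is $\langle W,v,\mu,e\rangle$ with $\mu$ an uncertainty measure on $W\ne\varnothing$, $v:\mathtt{Prop}\to2^W$ extended classically to $\|\chi\|\subseteq W$, $e(\mathtt{B}\chi)=\mu(\|\chi\|)$, and $e$ extended to $\mathscr{L}_{\mathsf{QG}}$ by the bi-G\"odel operations. It is a $\mathsf{QPG}$ model if $\mu$ satisfies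 the Kraft--Pratt--Seidenberg conditions: for every $m\in\mathbb{N}$ and all $X_i,Y_i\subseteq W$ ($i\in\{0,\ldots,m\}$), if $\mu(X_j)\leq\mu(Y_j)$ for all $j<m$ and every $w\in W$ belongs to as many $X_i$'s as $Y_i$'s, then $\mu(X_m)\geq\mu(Y_m)$. $\alpha\in\mathscr{L}_{\mathsf{QG}}$ is $\mathsf{QPG}$ valid if $e(\alpha)=1$ in every $\mathsf{QPG}$ model. *)

theory Defs
  imports "HOL-Probability.Probability_Measure" "HOL-Library.Infinite_Typeclass"
begin

section \<open>Classical propositional formulas\<close>

datatype 'p cpl =
    CVar 'p
  | CNeg "'p cpl"
  | CAnd "'p cpl" "'p cpl"

primrec cpl_ext :: "'w set \<Rightarrow> ('p \<Rightarrow> 'w set) \<Rightarrow> 'p cpl \<Rightarrow> 'w set" where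
  "cpl_ext W v (CVar p) = v p"
| "cpl_ext W v (CNeg \<theta>) = W - cpl_ext W v \<theta>"
| "cpl_ext W v (CAnd \<theta> \<theta>') = cpl_ext W v \<theta> \<inter> cpl_ext W v \<theta>'"


section \<open>The logic QP\<close>

datatype 'p qp =
    QVar 'p
  | QNeg "'p qp"
  | QAnd "'p qp" "'p qp"
  | QLess "'p qp" "'p qp"

abbreviation QOr :: "'p qp \<Rightarrow> 'p qp \<Rightarrow> 'p qp" where
  "QOr \<phi> \<psi> \<equiv> QNeg (QAnd (QNeg \<phi>) (QNeg \<psi>))"

abbreviation QImp :: "'p qp \<Rightarrow> 'p qp \<Rightarrow> 'p qp" where
  "QImp \<phi> \<psi> \<equiv> QNeg (QAnd \<phi> (QNeg \<psi>))"

definition gaerdenfors_frame :: "'u set \<Rightarrow> ('u \<Rightarrow> 'u measure) \<Rightarrow> bool" where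
  "gaerdenfors_frame U P \<longleftrightarrow>
     U \<noteq> {} \<and> (\<forall>x\<in>U. prob_space (P x) \<and> space (P x) = U \<and> sets (P x) = Pow U)"

definition gaerdenfors_model ::
    "'u set \<Rightarrow> ('u \<Rightarrow> 'u measure) \<Rightarrow> ('p \<Rightarrow> 'u set) \<Rightarrow> bool" where
  "gaerdenfors_model U P v \<longleftrightarrow> gaerdenfors_frame U P \<and> (\<forall>p. v p \<subseteq> U)"

primrec qp_ext ::
    "'u set \<Rightarrow> ('u \<Rightarrow> 'u measure) \<Rightarrow> ('p \<Rightarrow> 'u set) \<Rightarrow> 'p qp \<Rightarrow> 'u set" where
  "qp_ext U P v (QVar p) = v p"
| "qp_ext U P v (QNeg \<phi>) = U - qp_ext U P v \<phi>"
| "qp_ext U P v (QAnd \<phi> \<psi>) = qp_ext U P v \<phi> \<inter> qp_ext U P v \<psi>"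
| "qp_ext U P v (QLess \<phi> \<psi>) =
     {x \<in> U. measure (P x) (qp_ext U P v \<phi>) \<le> measure (P x) (qp_ext U P v \<psi>)}"

definition qp_true ::
    "'u set \<Rightarrow> ('u \<Rightarrow> 'u measure) \<Rightarrow> ('p \<Rightarrow> 'u set) \<Rightarrow> 'p qp \<Rightarrow> bool" where
  "qp_true U P v \<phi> \<longleftrightarrow> qp_ext U P v \<phi> = U"

text \<open>
  HOL cannot quantify over types inside a formula, so validity refers to all models whose
  carrier is an arbitrary nonempty, possibly finite, subset of a type given as a parameter.
  The sort constraint excludes finite types, over which there would be no models with
  large carriers; models over a finite type have copies over every infinite type.
\<close>

definition qp_valid :: "'u::infinite itself \<Rightarrow> 'p qp \<Rightarrow> bool" where
  "qp_valid T \<phi> \<longleftrightarrow>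
     (\<forall>(U :: 'u set) P v. gaerdenfors_model U P v \<longrightarrow> qp_true U P v \<phi>)"


section \<open>Simple inequality formulas\<close>

text \<open>
  SIF is a datatype of its own rather than a subset of \<open>qp\<close>: its disjunction and implication
  are primitive for the translation into QG (where they are not definable from negation and
  conjunction), but abbreviations in QP.
\<close>

datatype 'p sif =
    SLess "'p cpl" "'p cpl"
  | SNeg "'p sif"
  | SAnd "'p sif" "'p sif"
  | SOr "'p sif" "'p sif"
  | SImp "'p sif" "'p sif"

primrec qp_of_cpl :: "'p cpl \<Rightarrow> 'p qp" where
  "qp_of_cpl (CVar p) = QVar p"
| "qp_of_cpl (CNeg \<theta>) = QNeg (qp_of_cpl \<theta>)"
| "qp_of_cpl (CAnd \<theta> \<theta>') = QAnd (qp_of_cpl \<theta>) (qp_of_cpl \<theta>')"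

primrec qp_of_sif :: "'p sif \<Rightarrow> 'p qp" where
  "qp_of_sif (SLess \<theta> \<theta>') = QLess (qp_of_cpl \<theta>) (qp_of_cpl \<theta>')"
| "qp_of_sif (SNeg \<phi>) = QNeg (qp_of_sif \<phi>)"
| "qp_of_sif (SAnd \<phi> \<psi>) = QAnd (qp_of_sif \<phi>) (qp_of_sif \<psi>)"
| "qp_of_sif (SOr \<phi> \<psi>) = QOr (qp_of_sif \<phi>) (qp_of_sif \<psi>)"
| "qp_of_sif (SImp \<phi> \<psi>) = QImp (qp_of_sif \<phi>) (qp_of_sif \<psi>)"


section \<open>Bi-Goedel operations and the language QG\<close>

definition bg_imp :: "real \<Rightarrow> real \<Rightarrow> real" where
  "bg_imp a b = (if a \<le> b then 1 else b)"

definition bg_coimp :: "real \<Rightarrow> real \<Rightarrow> real" where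
  "bg_coimp a b = (if a \<le> b then 0 else a)"

definition bg_neg :: "real \<Rightarrow> real" where
  "bg_neg a = (if a = 0 then 1 else 0)"

definition bg_delta :: "real \<Rightarrow> real" where
  "bg_delta a = (if a = 1 then 1 else 0)"

datatype 'p qg =
    Bel "'p cpl"
  | GNeg "'p qg"
  | GAnd "'p qg" "'p qg"
  | GOr "'p qg" "'p qg"
  | GImp "'p qg" "'p qg"
  | GCoimp "'p qg" "'p qg"

abbreviation GTop :: "'p qg \<Rightarrow> 'p qg" where
  "GTop \<alpha> \<equiv> GImp \<alpha> \<alpha>"

text \<open>
  The operator \<open>\<triangle>\<close> is the defined connective \<open>1 \<prec> (1 \<prec> \<alpha>)\<close>, with the constant \<open>1\<close> expressed
  as \<open>\<alpha> \<rightarrow> \<alpha>\<close>; \<open>qg_val_GDelta\<close> below recovers its truth function.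
\<close>

definition GDelta :: "'p qg \<Rightarrow> 'p qg" where
  "GDelta \<alpha> = GCoimp (GTop \<alpha>) (GCoimp (GTop \<alpha>) \<alpha>)"

primrec delta_tr :: "'p sif \<Rightarrow> 'p qg" where
  "delta_tr (SLess \<theta> \<theta>') = GDelta (GImp (Bel \<theta>) (Bel \<theta>'))"
| "delta_tr (SNeg \<phi>) = GNeg (delta_tr \<phi>)"
| "delta_tr (SAnd \<phi> \<psi>) = GAnd (delta_tr \<phi>) (delta_tr \<psi>)"
| "delta_tr (SOr \<phi> \<psi>) = GOr (delta_tr \<phi>) (delta_tr \<psi>)"
| "delta_tr (SImp \<phi> \<psi>) = GImp (delta_tr \<phi>) (delta_tr \<psi>)"


section \<open>QG and QPG models\<close>

text \<open>
  Measures are functions on all sets over the type, but only their values on subsets of the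
  carrier \<open>W\<close> are constrained or used.
\<close>

definition uncertainty_measure :: "'w set \<Rightarrow> ('w set \<Rightarrow> real) \<Rightarrow> bool" where
  "uncertainty_measure W \<mu> \<longleftrightarrow>
     (\<forall>X. X \<subseteq> W \<longrightarrow> \<mu> X \<in> {0..1}) \<and>
     (\<forall>X Y. X \<subseteq> Y \<and> Y \<subseteq> W \<longrightarrow> \<mu> X \<le> \<mu> Y) \<and>
     \<mu> W > \<mu> {}"

definition qg_model :: "'w set \<Rightarrow> ('p \<Rightarrow> 'w set) \<Rightarrow> ('w set \<Rightarrow> real) \<Rightarrow> bool" where
  "qg_model W v \<mu> \<longleftrightarrow> W \<noteq> {} \<and> (\<forall>p. v p \<subseteq> W) \<and> uncertainty_measure W \<mu>"

text \<open>
  The component \<open>e\<close> of a QG model is determined by the other three.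
\<close>

primrec qg_val :: "'w set \<Rightarrow> ('p \<Rightarrow> 'w set) \<Rightarrow> ('w set \<Rightarrow> real) \<Rightarrow> 'p qg \<Rightarrow> real" where
  "qg_val W v \<mu> (Bel \<theta>) = \<mu> (cpl_ext W v \<theta>)"
| "qg_val W v \<mu> (GNeg \<alpha>) = bg_neg (qg_val W v \<mu> \<alpha>)"
| "qg_val W v \<mu> (GAnd \<alpha> \<beta>) = min (qg_val W v \<mu> \<alpha>) (qg_val W v \<mu> \<beta>)"
| "qg_val W v \<mu> (GOr \<alpha> \<beta>) = max (qg_val W v \<mu> \<alpha>) (qg_val W v \<mu> \<beta>)"
| "qg_val W v \<mu> (GImp \<alpha> \<beta>) = bg_imp (qg_val W v \<mu> \<alpha>) (qg_val W v \<mu> \<beta>)"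
| "qg_val W v \<mu> (GCoimp \<alpha> \<beta>) = bg_coimp (qg_val W v \<mu> \<alpha>) (qg_val W v \<mu> \<beta>)"

definition kps :: "'w set \<Rightarrow> ('w set \<Rightarrow> real) \<Rightarrow> bool" where
  "kps W \<mu> \<longleftrightarrow>
     (\<forall>(m::nat) X Y.
        (\<forall>i\<le>m. X i \<subseteq> W \<and> Y i \<subseteq> W) \<and>
        (\<forall>j<m. \<mu> (X j) \<le> \<mu> (Y j)) \<and>
        (\<forall>w\<in>W. card {i. i \<le> m \<and> w \<in> X i} = card {i. i \<le> m \<and> w \<in> Y i})
        \<longrightarrow> \<mu> (X m) \<ge> \<mu> (Y m))"

definition qpg_model :: "'w set \<Rightarrow> ('p \<Rightarrow> 'w set) \<Rightarrow> ('w set \<Rightarrow> real) \<Rightarrow> bool" where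
  "qpg_model W v \<mu> \<longleftrightarrow> qg_model W v \<mu> \<and> kps W \<mu>"

definition qpg_valid :: "'w::infinite itself \<Rightarrow> 'p qg \<Rightarrow> bool" where
  "qpg_valid T \<alpha> \<longleftrightarrow>
     (\<forall>(W :: 'w set) v \<mu>. qpg_model W v \<mu> \<longrightarrow> qg_val W v \<mu> \<alpha> = 1)"


lemma cpl_ext_subset: "(\<And>p. v p \<subseteq> W) \<Longrightarrow> cpl_ext W v \<theta> \<subseteq> W"
  by (induction \<theta>) auto

lemma qg_val_range:
  assumes "qg_model W v \<mu>"
  shows "qg_val W v \<mu> \<alpha> \<in> {0..1}"
proof (induction \<alpha>)
  case (Bel \<theta>)
  have "cpl_ext W v \<theta> \<subseteq> W"
    using assms by (intro cpl_ext_subset) (auto simp: qg_model_def)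
  then show ?case
    using assms by (simp add: qg_model_def uncertainty_measure_def)
qed (auto simp: bg_neg_def bg_imp_def bg_coimp_def)

lemma qg_val_GDelta:
  assumes "qg_model W v \<mu>"
  shows "qg_val W v \<mu> (GDelta \<alpha>) = bg_delta (qg_val W v \<mu> \<alpha>)"
  using qg_val_range[OF assms, of \<alpha>]
  by (auto simp: GDelta_def bg_imp_def bg_coimp_def bg_delta_def)

lemma qp_ext_qp_of_cpl: "qp_ext U P v (qp_of_cpl \<theta>) = cpl_ext U v \<theta>"
  by (induction \<theta>) auto

end

theory Submission
  imports Defs "HOL-Library.Multiset"
begin

text \<open>
  At a single point, a simple inequality formula is a Boolean combination of comparisons
  between events, and the translation of such a formula has value \<open>0\<close> or \<open>1\<close>. In either
  semantics its truth is therefore the classical truth of one and the same Boolean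
  combination (\<open>sif_holds\<close>), where only the comparison relation varies: it comes from a
  probability measure in QP and from an uncertainty measure satisfying the
  Kraft--Pratt--Seidenberg conditions in QPG. The theorem says that these two kinds of measure
  realise the same comparison patterns on finitely many events.

  A probability measure satisfies the conditions because the sum of the probabilities of
  \<open>X\<^sub>0, \<dots>, X\<^sub>m\<close> is the integral of the function that counts how many of the \<open>X\<^sub>i\<close> contain
  a point (\<open>prob_space_qpg_model\<close>). Conversely, on a \<^emph>\<open>finite\<close> carrier the comparisons induced
  by a measure satisfying the conditions are also induced by a probability measure
  (\<open>kps_representation\<close>). This is the theorem of Kraft, Pratt, Seidenberg and Scott, and it
  rests on the Farkas lemma: either there are point weights with the right comparisons, or
  some nonnegative combination of comparison vectors cancels a strict comparison. The vectors
  have rational entries, so the coefficients can be taken rational and then, after clearing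
  denominators, natural. A combination with natural coefficients is a balanced family of sets
  of the kind that the conditions exclude.

  The reduction to finite carriers is a filtration (\<open>filtration\<close>): points that agree on the
  finitely many variables of the formula are identified. As the quotient is finite, it can be
  placed in any infinite type, so the same step also carries models between the two carrier
  types of the statement.
\<close>

section \<open>The Farkas lemma over an ordered field\<close>

definition dot :: "'i set \<Rightarrow> ('i \<Rightarrow> 'k::linordered_field) \<Rightarrow> ('i \<Rightarrow> 'k) \<Rightarrow> 'k" where
  "dot W a x = (\<Sum>w\<in>W. a w * x w)"

lemma dot_diff_scale_left: "dot W (\<lambda>w. a w - c * b w) x = dot W a x - c * dot W b x"
  by (simp add: dot_def algebra_simps sum_subtractf sum_distrib_left)

lemma dot_diff_scale_right: "dot W a (\<lambda>w. x w - c * y w) = dot W a x - c * dot W a y"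
  by (simp add: dot_def algebra_simps sum_subtractf sum_distrib_left)

lemma dot_scale_right: "dot W a (\<lambda>w. c * x w) = c * dot W a x"
  by (simp add: dot_def algebra_simps sum_distrib_left)

text \<open>
  Bartl's induction on the number of constraints. If the constraint \<open>b \<cdot> x \<ge> 0\<close>, where
  \<open>b = a k\<close>, cannot be dropped, some \<open>z\<close> satisfies all other constraints but has \<open>g \<cdot> z < 0\<close>. It
  then violates this constraint and can be scaled to \<open>b \<cdot> z = -1\<close>. Projecting along \<open>z\<close> onto the
  hyperplane \<open>b \<cdot> x = 0\<close> disposes of \<open>b\<close>, and the induction hypothesis applies to the
  projected vectors. All steps are field operations, so rational vectors get rational
  coefficients.
\<close>

lemma farkas:
  fixes a :: "'j \<Rightarrow> 'i \<Rightarrow> 'k::linordered_field"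
  assumes "finite J" "finite W"
    and "\<And>x. (\<And>j. j \<in> J \<Longrightarrow> dot W (a j) x \<ge> 0) \<Longrightarrow> dot W g x \<ge> 0"
  shows "\<exists>c. (\<forall>j\<in>J. c j \<ge> 0) \<and> (\<forall>w\<in>W. g w = (\<Sum>j\<in>J. c j * a j w))"
  using assms(1,3)
proof (induction J arbitrary: a g rule: finite_induct)
  case empty
  have "dot W g (\<lambda>w. - g w) \<ge> 0"
    by (rule empty) simp
  then have "(\<Sum>w\<in>W. g w * g w) \<le> 0"
    by (simp add: dot_def sum_negf)
  then have "(\<Sum>w\<in>W. g w * g w) = 0"
    by (meson order_antisym sum_nonneg zero_le_square)
  then have "\<forall>w\<in>W. g w = 0"
    using assms(2) by (simp add: sum_nonneg_eq_0_iff)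
  then show ?case by simp
next
  case (insert k J)
  show ?case
  proof (cases "\<forall>x. (\<forall>j\<in>J. dot W (a j) x \<ge> 0) \<longrightarrow> dot W g x \<ge> 0")
    case True
    then obtain c where c: "\<forall>j\<in>J. c j \<ge> 0" "\<forall>w\<in>W. g w = (\<Sum>j\<in>J. c j * a j w)"
      using insert.IH[of a g] by blast
    have "(\<Sum>j\<in>J. (c(k := 0)) j * a j w) = (\<Sum>j\<in>J. c j * a j w)" for w
      using insert.hyps by (intro sum.cong) auto
    then have "\<forall>w\<in>W. g w = (\<Sum>j\<in>insert k J. (c(k := 0)) j * a j w)"
      using c insert.hyps by simp
    moreover have "\<forall>j\<in>insert k J. (c(k := 0)) j \<ge> 0"
      using c by auto
    ultimately show ?thesis by blast
  next
    case False
    then obtain y where y: "\<forall>j\<in>J. dot W (a j) y \<ge> 0" "dot W g y < 0"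
      by (auto simp: not_le)
    have neg: "dot W (a k) y < 0"
      using insert.prems[of y] y by fastforce
    define z where "z = (\<lambda>w. inverse (- dot W (a k) y) * y w)"
    have zk: "dot W (a k) z = -1"
      unfolding z_def dot_scale_right using neg by (simp add: field_simps)
    have zJ: "dot W (a j) z \<ge> 0" if "j \<in> J" for j
    proof -
      have "inverse (- dot W (a k) y) \<ge> 0" using neg by simp
      then show ?thesis using y that unfolding z_def dot_scale_right
        by (intro mult_nonneg_nonneg) auto
    qed
    have zg: "dot W g z < 0"
      using y neg unfolding z_def dot_scale_right
      by (intro mult_pos_neg) auto
    define a' where "a' = (\<lambda>j w. a j w - (- dot W (a j) z) * a k w)"
    define g' where "g' = (\<lambda>w. g w - (- dot W g z) * a k w)"
    have "dot W g' x \<ge> 0" if x: "\<And>j. j \<in> J \<Longrightarrow> dot W (a' j) x \<ge> 0" for x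
    proof -
      define x' where "x' = (\<lambda>w. x w - (- dot W (a k) x) * z w)"
      have proj: "dot W b x' = dot W (\<lambda>w. b w - (- dot W b z) * a k w) x" for b
        unfolding x'_def dot_diff_scale_left dot_diff_scale_right by simp
      have "dot W (a k) x' = 0"
        unfolding x'_def dot_diff_scale_right by (simp add: zk)
      then have "dot W (a j) x' \<ge> 0" if "j \<in> insert k J" for j
        using that x[of j] unfolding a'_def proj[symmetric] by auto
      then show ?thesis
        using insert.prems[of x'] unfolding g'_def proj[symmetric] by blast
    qed
    then obtain c where c: "\<forall>j\<in>J. c j \<ge> 0" "\<forall>w\<in>W. g' w = (\<Sum>j\<in>J. c j * a' j w)"
      using insert.IH[of a' g'] by blast
    define d where "d = (\<Sum>j\<in>J. c j * dot W (a j) z) - dot W g z"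
    have "(\<Sum>j\<in>J. c j * dot W (a j) z) \<ge> 0"
      using c zJ by (intro sum_nonneg mult_nonneg_nonneg) auto
    then have "d \<ge> 0" using zg by (simp add: d_def)
    have sum_upd: "(\<Sum>j\<in>J. (c(k := d)) j * a j w) = (\<Sum>j\<in>J. c j * a j w)" for w
      using insert.hyps by (intro sum.cong) auto
    have "g w = (\<Sum>j\<in>insert k J. (c(k := d)) j * a j w)" if "w \<in> W" for w
    proof -
      have "g w = (\<Sum>j\<in>J. c j * a' j w) - dot W g z * a k w"
        using c(2) that by (auto simp: g'_def)
      also have "(\<Sum>j\<in>J. c j * a' j w) =
          (\<Sum>j\<in>J. c j * a j w) + (\<Sum>j\<in>J. c j * dot W (a j) z) * a k w"
        by (simp add: a'_def algebra_simps sum.distrib sum_distrib_left sum_distrib_right)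
      finally have "g w = d * a k w + (\<Sum>j\<in>J. c j * a j w)"
        by (simp add: d_def algebra_simps)
      then show ?thesis
        using insert.hyps by (simp add: sum_upd fun_upd_same del: fun_upd_apply)
    qed
    moreover have "\<forall>j\<in>insert k J. (c(k := d)) j \<ge> 0"
      using c \<open>d \<ge> 0\<close> by auto
    ultimately show ?thesis by blast
  qed
qed

lemma rat_common_denominator:
  fixes c :: "'j \<Rightarrow> rat"
  assumes "finite J" "\<forall>j\<in>J. c j \<ge> 0"
  shows "\<exists>N n. N > 0 \<and> (\<forall>j\<in>J. of_nat N * c j = of_nat (n j))"
  using assms
proof (induction J rule: finite_induct)
  case empty
  then show ?case by auto
next
  case (insert k J)
  then obtain N n where N: "N > 0" "\<forall>j\<in>J. of_nat N * c j = of_nat (n j)"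
    by auto
  obtain p q where pq: "c k = Fract p q" "q > 0"
    by (cases "c k") auto
  then have "p \<ge> 0" using insert.prems by (simp add: zero_le_Fract_iff)
  have q: "of_nat (nat q) * c k = of_nat (nat p)"
    using pq \<open>p \<ge> 0\<close> by (simp add: Fract_of_int_quotient)
  define n' where "n' = (\<lambda>j. if j = k then N * nat p else nat q * n j)"
  have "of_nat (nat q * N) * c j = of_nat (n' j)" if "j \<in> insert k J" for j
  proof (cases "j = k")
    case True
    have "of_nat (nat q * N) * c k = of_nat N * (of_nat (nat q) * c k)"
      by (simp only: of_nat_mult mult.assoc mult.left_commute)
    then show ?thesis using True q by (simp add: n'_def)
  next
    case False
    have "of_nat (nat q * N) * c j = of_nat (nat q) * (of_nat N * c j)"
      by (simp only: of_nat_mult mult.assoc)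
    then show ?thesis using False that N by (simp add: n'_def)
  qed
  moreover have "nat q * N > 0" using pq N by simp
  ultimately show ?case by blast
qed


section \<open>Representation of comparisons by probability measures\<close>

text \<open>
  The value at \<open>w\<close> of the vector that a comparison between two events contributes. Weights
  \<open>x\<close> respect the comparison of \<open>X\<close> with \<open>Y\<close> iff their product with this vector is nonnegative,
  and the pairs \<open>(X\<^sub>i, Y\<^sub>i)\<close> are balanced iff their vectors sum to zero.
\<close>

definition comp_vec :: "'w set \<times> 'w set \<Rightarrow> 'w \<Rightarrow> rat" where
  "comp_vec e w = of_bool (w \<in> snd e) - of_bool (w \<in> fst e)"

lemma dot_comp_vec:
  assumes "finite W" "X \<subseteq> W" "Y \<subseteq> W"
  shows "dot W (comp_vec (X, Y)) x = sum x Y - sum x X"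
proof -
  have "(\<Sum>w\<in>W. of_bool (w \<in> Z) * x w) = sum x Z" if "Z \<subseteq> W" for Z
    using assms(1) that by (simp add: sum.inter_restrict[symmetric] of_bool_def if_distrib
        [of "\<lambda>c. c * _"] Int_absorb1 cong: if_cong)
  then show ?thesis
    using assms by (simp add: dot_def comp_vec_def left_diff_distrib sum_subtractf)
qed

text \<open>
  In the Kraft--Pratt--Seidenberg conditions the order of the pairs other than the last one is
  immaterial, so multisets can replace indexed families.
\<close>

lemma kps_multiset:
  assumes "kps W \<mu>"
    and M: "\<And>e. e \<in># M \<Longrightarrow> fst e \<subseteq> W \<and> snd e \<subseteq> W \<and> \<mu> (fst e) \<le> \<mu> (snd e)"
    and XY: "X \<subseteq> W" "Y \<subseteq> W"
    and bal: "\<And>w. w \<in> W \<Longrightarrow> (\<Sum>e\<in>#add_mset (X, Y) M. comp_vec e w) = 0"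
  shows "\<mu> Y \<le> \<mu> X"
proof -
  obtain L where L: "mset L = M" using ex_mset by blast
  define K where "K = L @ [(X, Y)]"
  define m where "m = length L"
  have last: "K ! m = (X, Y)" by (simp add: K_def m_def)
  have init: "K ! j \<in># M" if "j < m" for j
    using that by (auto simp: K_def m_def nth_append simp flip: L)
  have card: "(of_nat (card {i. i \<le> m \<and> w \<in> Z i}) :: rat) = (\<Sum>i\<le>m. of_bool (w \<in> Z i))"
    for w and Z :: "nat \<Rightarrow> 'a set"
    by (simp add: of_bool_def sum.If_cases Int_def)
  have "card {i. i \<le> m \<and> w \<in> fst (K ! i)} = card {i. i \<le> m \<and> w \<in> snd (K ! i)}"
    if "w \<in> W" for w
  proof -
    have "0 = (\<Sum>e\<in>#mset K. comp_vec e w)"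
      using bal[OF that] by (simp add: K_def L)
    also have "\<dots> = (\<Sum>e\<leftarrow>K. comp_vec e w)"
      by (metis mset_map sum_mset_sum_list)
    also have "\<dots> = (\<Sum>i\<le>m. comp_vec (K ! i) w)"
      by (simp add: sum_list_sum_nth K_def m_def atLeast0LessThan lessThan_Suc_atMost
          del: sum.lessThan_Suc sum_list_append map_append)
    also have "\<dots> = of_nat (card {i. i \<le> m \<and> w \<in> snd (K ! i)})
                  - of_nat (card {i. i \<le> m \<and> w \<in> fst (K ! i)})"
      by (simp add: comp_vec_def sum_subtractf card)
    finally show ?thesis by simp
  qed
  moreover have "\<forall>i\<le>m. fst (K ! i) \<subseteq> W \<and> snd (K ! i) \<subseteq> W"
    using M init XY last by (metis fst_conv le_neq_implies_less snd_conv)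
  moreover have "\<forall>j<m. \<mu> (fst (K ! j)) \<le> \<mu> (snd (K ! j))"
    using M init by blast
  ultimately have "\<mu> (snd (K ! m)) \<le> \<mu> (fst (K ! m))"
    using assms(1)[unfolded kps_def, rule_format,
        of m "\<lambda>i. fst (K ! i)" "\<lambda>i. snd (K ! i)"] by blast
  then show ?thesis by (simp add: last)
qed

text \<open>
  If no weights realised the strict comparison, the Farkas lemma would express the negative of
  its vector by the vectors of all comparisons. With denominators cleared, this is a balanced
  multiset in which the strict pair occurs at least once, so it can be put last.
\<close>

lemma kps_weights_strict:
  assumes "finite W" "kps W \<mu>" and XY: "X \<subseteq> W" "Y \<subseteq> W" "\<mu> X < \<mu> Y"
  shows "\<exists>x :: 'w \<Rightarrow> rat. (\<forall>A B. A \<subseteq> W \<and> B \<subseteq> W \<and> \<mu> A \<le> \<mu> B \<longrightarrow> sum x A \<le> sum x B) \<and>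
     sum x X < sum x Y"
proof (rule ccontr)
  assume no: "\<not> ?thesis"
  define J where "J = {e. fst e \<subseteq> W \<and> snd e \<subseteq> W \<and> \<mu> (fst e) \<le> \<mu> (snd e)}"
  have "J \<subseteq> Pow W \<times> Pow W" by (auto simp: J_def)
  then have "finite J"
    using assms(1) by (meson finite_Pow_iff finite_SigmaI finite_subset)
  have neg: "dot W (\<lambda>w. - comp_vec (X, Y) w) x = sum x X - sum x Y" for x
    using dot_diff_scale_left[of W "\<lambda>_. 0" 1 "comp_vec (X, Y)" x]
      dot_comp_vec[OF assms(1) XY(1,2), of x] by (simp add: dot_def)
  have "dot W (\<lambda>w. - comp_vec (X, Y) w) x \<ge> 0"
    if x: "\<And>e. e \<in> J \<Longrightarrow> dot W (comp_vec e) x \<ge> 0" for x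
  proof -
    have "sum x A \<le> sum x B" if "A \<subseteq> W" "B \<subseteq> W" "\<mu> A \<le> \<mu> B" for A B
      using x[of "(A, B)"] that dot_comp_vec[OF assms(1) that(1,2), of x]
      by (simp add: J_def)
    then show ?thesis using no neg by (metis diff_ge_0_iff_ge not_le)
  qed
  then obtain c where c: "\<forall>e\<in>J. c e \<ge> 0"
      "\<forall>w\<in>W. - comp_vec (X, Y) w = (\<Sum>e\<in>J. c e * comp_vec e w)"
    using farkas[OF \<open>finite J\<close> assms(1), of comp_vec "\<lambda>w. - comp_vec (X, Y) w"] by blast
  obtain N n where N: "N > 0" "\<forall>e\<in>J. of_nat N * c e = of_nat (n e)"
    using rat_common_denominator[OF \<open>finite J\<close> c(1)] by blast
  \<comment> \<open>The remaining copy of the strict pair is kept for the last position.\<close>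
  define M where "M = replicate_mset (N - 1) (X, Y) + (\<Sum>e\<in>J. replicate_mset (n e) e)"
  have M_J: "e \<in> J" if "e \<in># M" for e
    using that XY \<open>finite J\<close>
    by (auto simp: M_def J_def set_mset_sum split: if_splits)
  have sum_J: "(\<Sum>e\<in>#(\<Sum>e\<in>J. replicate_mset (n e) e). h e) = (\<Sum>e\<in>J. of_nat (n e) * h e)"
    for h :: "'w set \<times> 'w set \<Rightarrow> rat"
    using \<open>finite J\<close> by (induction J rule: finite_induct) auto
  have "(\<Sum>e\<in>#add_mset (X, Y) M. comp_vec e w) = 0" if "w \<in> W" for w
  proof -
    have "add_mset (X, Y) M = replicate_mset N (X, Y) + (\<Sum>e\<in>J. replicate_mset (n e) e)"
      using N(1) by (cases N) (auto simp: M_def)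
    then have "(\<Sum>e\<in>#add_mset (X, Y) M. comp_vec e w) =
        of_nat N * comp_vec (X, Y) w + (\<Sum>e\<in>J. of_nat (n e) * comp_vec e w)"
      by (simp add: sum_J)
    also have "(\<Sum>e\<in>J. of_nat (n e) * comp_vec e w) = of_nat N * (\<Sum>e\<in>J. c e * comp_vec e w)"
      using N(2) by (simp add: sum_distrib_left flip: mult.assoc)
    also have "(\<Sum>e\<in>J. c e * comp_vec e w) = - comp_vec (X, Y) w"
      using c(2) that by simp
    finally show ?thesis by simp
  qed
  then have "\<mu> Y \<le> \<mu> X"
    using kps_multiset[OF assms(2) _ XY(1,2), of M] M_J by (auto simp: J_def)
  then show False using XY by simp
qed

text \<open>
  Weights that respect all comparisons are closed under addition, so adding up one solution
  for each strict comparison makes all strict comparisons strict at once.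
\<close>

lemma kps_weights:
  assumes "finite W" "kps W \<mu>"
  shows "\<exists>x :: 'w \<Rightarrow> rat. \<forall>A B. A \<subseteq> W \<and> B \<subseteq> W \<longrightarrow> (\<mu> A \<le> \<mu> B \<longleftrightarrow> sum x A \<le> sum x B)"
proof -
  define S where "S = {e. fst e \<subseteq> W \<and> snd e \<subseteq> W \<and> \<mu> (fst e) < \<mu> (snd e)}"
  have "S \<subseteq> Pow W \<times> Pow W" by (auto simp: S_def)
  then have fin: "finite S"
    using assms(1) by (meson finite_Pow_iff finite_SigmaI finite_subset)
  have "\<forall>e\<in>S. \<exists>x :: 'w \<Rightarrow> rat.
      (\<forall>A B. A \<subseteq> W \<and> B \<subseteq> W \<and> \<mu> A \<le> \<mu> B \<longrightarrow> sum x A \<le> sum x B) \<and>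
      sum x (fst e) < sum x (snd e)"
    using kps_weights_strict[OF assms] by (auto simp: S_def)
  then obtain x :: "_ \<Rightarrow> 'w \<Rightarrow> rat" where
    le: "\<And>e A B. e \<in> S \<Longrightarrow> A \<subseteq> W \<Longrightarrow> B \<subseteq> W \<Longrightarrow> \<mu> A \<le> \<mu> B \<Longrightarrow> sum (x e) A \<le> sum (x e) B"
    and less: "\<And>e. e \<in> S \<Longrightarrow> sum (x e) (fst e) < sum (x e) (snd e)"
    by metis
  define y where "y = (\<lambda>w. \<Sum>e\<in>S. x e w)"
  have y: "sum y A = (\<Sum>e\<in>S. sum (x e) A)" for A
    unfolding y_def by (rule sum.swap)
  have "\<mu> A \<le> \<mu> B \<longleftrightarrow> sum y A \<le> sum y B" if "A \<subseteq> W" "B \<subseteq> W" for A B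
  proof (cases "\<mu> A \<le> \<mu> B")
    case True
    then show ?thesis using le that by (auto simp: y intro: sum_mono)
  next
    case False
    then have e: "(B, A) \<in> S" using that by (auto simp: S_def)
    have "sum y B < sum y A"
      unfolding y
      using e le[OF _ that(2,1)] less[OF e] False
      by (intro sum_strict_mono_ex1[OF fin]) force+
    then show ?thesis using False by simp
  qed
  then show ?thesis by blast
qed

text \<open>
  Monotonicity makes the weights nonnegative, and \<open>\<mu> {} < \<mu> W\<close> makes their total positive, so
  they can be normalised.
\<close>

theorem kps_representation:
  assumes "finite W" "uncertainty_measure W \<mu>" "kps W \<mu>"
  obtains M where "prob_space M" "space M = W" "sets M = Pow W"
    "\<And>A B. A \<subseteq> W \<Longrightarrow> B \<subseteq> W \<Longrightarrow> measure M A \<le> measure M B \<longleftrightarrow> \<mu> A \<le> \<mu> B"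
proof -
  obtain x :: "'a \<Rightarrow> rat" where
    x: "\<And>A B. A \<subseteq> W \<Longrightarrow> B \<subseteq> W \<Longrightarrow> \<mu> A \<le> \<mu> B \<longleftrightarrow> sum x A \<le> sum x B"
    using kps_weights[OF assms(1,3)] by blast
  have "\<mu> {} \<le> \<mu> {w}" if "w \<in> W" for w
    using assms(2) that by (auto simp: uncertainty_measure_def)
  then have nonneg: "x w \<ge> 0" if "w \<in> W" for w
    using x[of "{}" "{w}"] that by simp
  define t where "t = sum x W"
  have "\<not> \<mu> W \<le> \<mu> {}"
    using assms(2) by (simp add: uncertainty_measure_def)
  then have "t > 0"
    using x[of W "{}"] by (simp add: t_def)
  define r :: "'a \<Rightarrow> real" where "r w = of_rat (x w / t)" for w
  have r_nonneg: "r w \<ge> 0" if "w \<in> W" for w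
    using nonneg[OF that] \<open>t > 0\<close> by (simp add: r_def)
  have r_sum: "sum r A = of_rat (sum x A / t)" for A
    by (simp add: r_def of_rat_sum sum_divide_distrib)
  define M where "M = point_measure W (\<lambda>w. ennreal (r w))"
  have em: "emeasure M A = ennreal (sum r A)" if "A \<subseteq> W" for A
  proof -
    have "emeasure M A = (\<Sum>w\<in>A. ennreal (r w))"
      unfolding M_def by (rule emeasure_point_measure_finite[OF assms(1) that])
    also have "\<dots> = ennreal (sum r A)"
      using r_nonneg that by (intro sum_ennreal) auto
    finally show ?thesis .
  qed
  have me: "measure M A = sum r A" if "A \<subseteq> W" for A
    using em[OF that] r_nonneg that by (auto simp: measure_def intro!: enn2real_ennreal sum_nonneg)
  have sp: "space M = W" and se: "sets M = Pow W"
    by (simp_all add: M_def space_point_measure sets_point_measure)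
  have "emeasure M (space M) = 1"
    using \<open>t > 0\<close> by (simp add: sp em r_sum t_def)
  then have "prob_space M" by (rule prob_spaceI)
  moreover have "measure M A \<le> measure M B \<longleftrightarrow> \<mu> A \<le> \<mu> B" if "A \<subseteq> W" "B \<subseteq> W" for A B
    using x[OF that] \<open>t > 0\<close>
    by (simp add: me that r_sum of_rat_less_eq divide_le_cancel)
  ultimately show ?thesis using that sp se by blast
qed


section \<open>Probability measures satisfy the Kraft--Pratt--Seidenberg conditions\<close>

lemma prob_space_qpg_model:
  assumes "prob_space M" "sets M = Pow (space M)" "\<And>p. v p \<subseteq> space M"
  shows "qpg_model (space M) v (measure M)"
proof -
  interpret prob_space M by fact
  have count: "(\<Sum>i\<le>m. measure M (Z i)) =
      (\<integral>w. real (card {i. i \<le> m \<and> w \<in> Z i}) \<partial>M)"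
    if "\<And>i. i \<le> m \<Longrightarrow> Z i \<subseteq> space M" for m :: nat and Z
  proof -
    have Z: "Z i \<in> sets M" if "i \<le> m" for i
      using \<open>\<And>i. i \<le> m \<Longrightarrow> Z i \<subseteq> space M\<close>[OF that] assms(2) by simp
    have "(\<Sum>i\<le>m. measure M (Z i)) = (\<Sum>i\<le>m. \<integral>w. indicator (Z i) w \<partial>M)"
      using Z by (intro sum.cong) (auto simp: sets.Int_space_eq2)
    also have "\<dots> = (\<integral>w. (\<Sum>i\<le>m. indicator (Z i) w) \<partial>M)"
      using Z by (intro Bochner_Integration.integral_sum[symmetric]) (auto simp: less_top[symmetric])
    also have "(\<lambda>w. \<Sum>i\<le>m. indicator (Z i) w :: real) = (\<lambda>w. real (card {i. i \<le> m \<and> w \<in> Z i}))"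
      by (auto simp: indicator_def of_bool_def sum.If_cases Int_def)
    finally show ?thesis .
  qed
  have "kps (space M) (measure M)"
    unfolding kps_def
  proof (intro allI impI, elim conjE)
    fix m :: nat and X Y :: "nat \<Rightarrow> 'a set"
    assume sub: "\<forall>i\<le>m. X i \<subseteq> space M \<and> Y i \<subseteq> space M"
      and le: "\<forall>j<m. measure M (X j) \<le> measure M (Y j)"
      and bal: "\<forall>w\<in>space M. card {i. i \<le> m \<and> w \<in> X i} = card {i. i \<le> m \<and> w \<in> Y i}"
    have "(\<Sum>i\<le>m. measure M (X i)) = (\<Sum>i\<le>m. measure M (Y i))"
      using sub bal by (simp add: count cong: Bochner_Integration.integral_cong)
    moreover have "(\<Sum>i<m. measure M (X i)) \<le> (\<Sum>i<m. measure M (Y i))"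
      using le by (intro sum_mono) auto
    ultimately show "measure M (Y m) \<le> measure M (X m)"
      by (simp flip: lessThan_Suc_atMost)
  qed
  moreover have "uncertainty_measure (space M) (measure M)"
    using assms(2) by (auto simp: uncertainty_measure_def prob_space intro!: finite_measure_mono)
  ultimately show ?thesis
    using assms(3) not_empty by (simp add: qpg_model_def qg_model_def)
qed


section \<open>Quotients of models\<close>

lemma qpg_model_quotient:
  fixes h :: "'a \<Rightarrow> 'b"
  assumes "qpg_model W v \<mu>" "\<And>p. v' p \<subseteq> h ` W"
  shows "qpg_model (h ` W) v' (\<lambda>X. \<mu> {w \<in> W. h w \<in> X})"
proof -
  have ne: "W \<noteq> {}" and um: "uncertainty_measure W \<mu>" and "kps W \<mu>"
    using assms(1) by (auto simp: qpg_model_def qg_model_def)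
  have "uncertainty_measure (h ` W) (\<lambda>X. \<mu> {w \<in> W. h w \<in> X})"
    unfolding uncertainty_measure_def
  proof (intro conjI allI impI)
    fix X
    show "\<mu> {w \<in> W. h w \<in> X} \<in> {0..1}"
      using um by (simp add: uncertainty_measure_def)
  next
    fix X Y assume "X \<subseteq> Y \<and> Y \<subseteq> h ` W"
    then have "{w \<in> W. h w \<in> X} \<subseteq> {w \<in> W. h w \<in> Y}" by auto
    then show "\<mu> {w \<in> W. h w \<in> X} \<le> \<mu> {w \<in> W. h w \<in> Y}"
      using um by (simp add: uncertainty_measure_def)
  next
    have "{w \<in> W. h w \<in> h ` W} = W" by auto
    then show "\<mu> {w \<in> W. h w \<in> {}} < \<mu> {w \<in> W. h w \<in> h ` W}"
      using um by (simp add: uncertainty_measure_def)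
  qed
  moreover have "kps (h ` W) (\<lambda>X. \<mu> {w \<in> W. h w \<in> X})"
    unfolding kps_def
  proof (intro allI impI, elim conjE)
    fix m :: nat and X Y :: "nat \<Rightarrow> 'b set"
    assume le: "\<forall>j<m. \<mu> {w \<in> W. h w \<in> X j} \<le> \<mu> {w \<in> W. h w \<in> Y j}"
      and bal: "\<forall>u\<in>h ` W. card {i. i \<le> m \<and> u \<in> X i} = card {i. i \<le> m \<and> u \<in> Y i}"
    have "\<forall>w\<in>W. card {i. i \<le> m \<and> w \<in> {w \<in> W. h w \<in> X i}} =
                 card {i. i \<le> m \<and> w \<in> {w \<in> W. h w \<in> Y i}}"
      using bal by simp
    then show "\<mu> {w \<in> W. h w \<in> Y m} \<le> \<mu> {w \<in> W. h w \<in> X m}"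
      using \<open>kps W \<mu>\<close>[unfolded kps_def, rule_format,
          of m "\<lambda>i. {w \<in> W. h w \<in> X i}" "\<lambda>i. {w \<in> W. h w \<in> Y i}"] le by blast
  qed
  ultimately show ?thesis
    using assms(2) ne by (simp add: qpg_model_def qg_model_def)
qed

text \<open>
  A point is sent to (a code in the target type of) the set of those variables in \<open>V\<close> that hold
  at it. This is all that formulas over \<open>V\<close> can see of the point.
\<close>

lemma filtration:
  fixes W :: "'a set" and v :: "'p \<Rightarrow> 'a set"
  assumes "finite V"
  obtains h :: "'a \<Rightarrow> 'b::infinite" and v' where "finite (h ` W)" "\<And>p. v' p \<subseteq> h ` W"
    "\<And>\<theta>. set_cpl \<theta> \<subseteq> V \<Longrightarrow> {x \<in> W. h x \<in> cpl_ext (h ` W) v' \<theta>} = {x \<in> W. x \<in> cpl_ext W v \<theta>}"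
proof -
  obtain g :: "'p set \<Rightarrow> 'b" where g: "inj_on g (Pow V)"
    using arb_inj_on_finite_infinite[of "Pow V"] assms by auto
  define h where "h x = g {p \<in> V. x \<in> v p}" for x
  define v' where "v' p = (if p \<in> V then h ` (v p \<inter> W) else {})" for p
  have "h ` W \<subseteq> g ` Pow V" by (auto simp: h_def)
  then have "finite (h ` W)" using assms by (meson finite_Pow_iff finite_imageI finite_subset)
  moreover have "v' p \<subseteq> h ` W" for p by (auto simp: v'_def)
  moreover have "{x \<in> W. h x \<in> cpl_ext (h ` W) v' \<theta>} = {x \<in> W. x \<in> cpl_ext W v \<theta>}"
    if "set_cpl \<theta> \<subseteq> V" for \<theta>
    using that
  proof (induction \<theta>)
    case (CVar p)
    have "x \<in> v p" if "h x = h y" "y \<in> v p" for x y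
    proof -
      have "{p \<in> V. x \<in> v p} = {p \<in> V. y \<in> v p}"
        using that(1) g unfolding h_def by (auto dest!: inj_onD)
      then show ?thesis using that CVar by auto
    qed
    then show ?case using CVar by (auto simp: v'_def)
  qed auto
  ultimately show ?thesis using that by blast
qed


section \<open>Truth of simple inequality formulas\<close>

primrec sif_holds :: "('p cpl \<Rightarrow> 'p cpl \<Rightarrow> bool) \<Rightarrow> 'p sif \<Rightarrow> bool" where
  "sif_holds R (SLess \<theta> \<theta>') = R \<theta> \<theta>'"
| "sif_holds R (SNeg \<phi>) = (\<not> sif_holds R \<phi>)"
| "sif_holds R (SAnd \<phi> \<psi>) = (sif_holds R \<phi> \<and> sif_holds R \<psi>)"
| "sif_holds R (SOr \<phi> \<psi>) = (sif_holds R \<phi> \<or> sif_holds R \<psi>)"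
| "sif_holds R (SImp \<phi> \<psi>) = (sif_holds R \<phi> \<longrightarrow> sif_holds R \<psi>)"

lemma sif_holds_cong:
  assumes "\<And>\<theta> \<theta>'. set_cpl \<theta> \<subseteq> set_sif \<phi> \<Longrightarrow> set_cpl \<theta>' \<subseteq> set_sif \<phi> \<Longrightarrow> R \<theta> \<theta>' \<longleftrightarrow> R' \<theta> \<theta>'"
  shows "sif_holds R \<phi> \<longleftrightarrow> sif_holds R' \<phi>"
  using assms
proof (induction \<phi>)
  case (SLess \<theta> \<theta>')
  then show ?case by simp
next
  case (SNeg \<phi>)
  then show ?case by simp
next
  case (SAnd \<phi> \<psi>)
  have "sif_holds R \<phi> \<longleftrightarrow> sif_holds R' \<phi>" by (rule SAnd.IH, rule SAnd.prems) auto
  moreover have "sif_holds R \<psi> \<longleftrightarrow> sif_holds R' \<psi>" by (rule SAnd.IH, rule SAnd.prems) auto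
  ultimately show ?case by simp
next
  case (SOr \<phi> \<psi>)
  have "sif_holds R \<phi> \<longleftrightarrow> sif_holds R' \<phi>" by (rule SOr.IH, rule SOr.prems) auto
  moreover have "sif_holds R \<psi> \<longleftrightarrow> sif_holds R' \<psi>" by (rule SOr.IH, rule SOr.prems) auto
  ultimately show ?case by simp
next
  case (SImp \<phi> \<psi>)
  have "sif_holds R \<phi> \<longleftrightarrow> sif_holds R' \<phi>" by (rule SImp.IH, rule SImp.prems) auto
  moreover have "sif_holds R \<psi> \<longleftrightarrow> sif_holds R' \<psi>" by (rule SImp.IH, rule SImp.prems) auto
  ultimately show ?case by simp
qed

definition measure_le :: "'w set \<Rightarrow> ('p \<Rightarrow> 'w set) \<Rightarrow> ('w set \<Rightarrow> real) \<Rightarrow> 'p cpl \<Rightarrow> 'p cpl \<Rightarrow> bool"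
  where "measure_le W v \<mu> \<theta> \<theta>' \<longleftrightarrow> \<mu> (cpl_ext W v \<theta>) \<le> \<mu> (cpl_ext W v \<theta>')"

lemma qp_ext_qp_of_sif:
  "x \<in> U \<Longrightarrow> x \<in> qp_ext U P v (qp_of_sif \<phi>) \<longleftrightarrow> sif_holds (measure_le U v (measure (P x))) \<phi>"
  by (induction \<phi>) (auto simp: qp_ext_qp_of_cpl measure_le_def)

lemma qp_ext_subset: "(\<And>p. v p \<subseteq> U) \<Longrightarrow> qp_ext U P v \<phi> \<subseteq> U"
  by (induction \<phi>) auto

text \<open>
  The operator \<open>\<triangle>\<close> makes the atoms two-valued, and on \<open>{0, 1}\<close> the bi-Goedel operations are the
  classical ones.
\<close>

lemma qg_val_delta_tr:
  assumes "qg_model W v \<mu>"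
  shows "qg_val W v \<mu> (delta_tr \<phi>) = (if sif_holds (measure_le W v \<mu>) \<phi> then 1 else 0)"
proof (induction \<phi>)
  case (SLess \<theta> \<theta>')
  have "\<mu> (cpl_ext W v \<theta>) \<le> 1"
    using qg_val_range[OF assms, of "Bel \<theta>"] by simp
  then show ?case
    by (auto simp: qg_val_GDelta[OF assms] bg_delta_def bg_imp_def measure_le_def)
qed (auto simp: bg_neg_def bg_imp_def)

lemma sif_holds_quotient:
  fixes v :: "'p \<Rightarrow> 'w set" and v' :: "'p \<Rightarrow> 'u set"
  assumes "\<And>p. v p \<subseteq> W"
    and "\<And>\<theta>. set_cpl \<theta> \<subseteq> set_sif \<phi> \<Longrightarrow>
      {x \<in> W. h x \<in> cpl_ext (h ` W) v' \<theta>} = {x \<in> W. x \<in> cpl_ext W v \<theta>}"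
  shows "sif_holds (measure_le (h ` W) v' (\<lambda>X. \<mu> {w \<in> W. h w \<in> X})) \<phi> \<longleftrightarrow>
    sif_holds (measure_le W v \<mu>) \<phi>"
proof -
  have "{x \<in> W. x \<in> cpl_ext W v \<theta>} = cpl_ext W v \<theta>" for \<theta>
    using cpl_ext_subset[of v W \<theta>] assms(1) by blast
  then show ?thesis
    by (intro sif_holds_cong) (simp add: measure_le_def assms(2))
qed

lemma finite_set_cpl: "finite (set_cpl \<theta>)"
  by (induction \<theta>) auto

lemma finite_set_sif: "finite (set_sif \<phi>)"
  by (induction \<phi>) (auto simp: finite_set_cpl)


section \<open>Equivalence of the two validities\<close>

lemma qp_valid_if_qpg_valid:
  fixes \<phi> :: "'p sif"
  assumes "qpg_valid TYPE('w::infinite) (delta_tr \<phi>)"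
  shows "qp_valid TYPE('u::infinite) (qp_of_sif \<phi>)"
  unfolding qp_valid_def qp_true_def
proof (intro allI impI)
  fix U :: "'u set" and P and v :: "'p \<Rightarrow> 'u set"
  assume G: "gaerdenfors_model U P v"
  then have v: "\<And>p. v p \<subseteq> U" by (simp add: gaerdenfors_model_def)
  have "x \<in> qp_ext U P v (qp_of_sif \<phi>)" if "x \<in> U" for x
  proof -
    have P: "prob_space (P x)" "space (P x) = U" "sets (P x) = Pow U"
      using G that by (auto simp: gaerdenfors_model_def gaerdenfors_frame_def)
    then have model: "qpg_model U v (measure (P x))"
      using prob_space_qpg_model[of "P x" v] v by simp
    obtain h :: "'u \<Rightarrow> 'w" and v' where "finite (h ` U)" and v': "\<And>p. v' p \<subseteq> h ` U" and
      eq: "\<And>\<theta>. set_cpl \<theta> \<subseteq> set_sif \<phi> \<Longrightarrow>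
        {x \<in> U. h x \<in> cpl_ext (h ` U) v' \<theta>} = {x \<in> U. x \<in> cpl_ext U v \<theta>}"
      using filtration[OF finite_set_sif[of \<phi>], of U v] by blast
    let ?\<mu> = "\<lambda>X. measure (P x) {y \<in> U. h y \<in> X}"
    have m: "qpg_model (h ` U) v' ?\<mu>"
      by (rule qpg_model_quotient[OF model v'])
    then have "qg_val (h ` U) v' ?\<mu> (delta_tr \<phi>) = 1"
      using assms by (simp add: qpg_valid_def)
    moreover have "qg_model (h ` U) v' ?\<mu>"
      using m by (simp add: qpg_model_def)
    ultimately have "sif_holds (measure_le (h ` U) v' ?\<mu>) \<phi>"
      by (simp add: qg_val_delta_tr split: if_splits)
    then have "sif_holds (measure_le U v (measure (P x))) \<phi>"
      using sif_holds_quotient[where v = v and W = U, OF v eq] by simp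
    then show ?thesis using that by (simp add: qp_ext_qp_of_sif)
  qed
  then show "qp_ext U P v (qp_of_sif \<phi>) = U"
    using qp_ext_subset[of v U] v by blast
qed

text \<open>
  The represented measure is used at every point of the quotient, since a simple inequality
  formula at a point depends only on the measure attached to that point.
\<close>

lemma qpg_valid_if_qp_valid:
  fixes \<phi> :: "'p sif"
  assumes "qp_valid TYPE('u::infinite) (qp_of_sif \<phi>)"
  shows "qpg_valid TYPE('w::infinite) (delta_tr \<phi>)"
  unfolding qpg_valid_def
proof (intro allI impI)
  fix W :: "'w set" and v :: "'p \<Rightarrow> 'w set" and \<mu>
  assume model: "qpg_model W v \<mu>"
  then have qg: "qg_model W v \<mu>" and v: "\<And>p. v p \<subseteq> W"
    by (auto simp: qpg_model_def qg_model_def)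
  obtain h :: "'w \<Rightarrow> 'u" and v' where fin: "finite (h ` W)" and v': "\<And>p. v' p \<subseteq> h ` W" and
    eq: "\<And>\<theta>. set_cpl \<theta> \<subseteq> set_sif \<phi> \<Longrightarrow>
      {x \<in> W. h x \<in> cpl_ext (h ` W) v' \<theta>} = {x \<in> W. x \<in> cpl_ext W v \<theta>}"
    using filtration[OF finite_set_sif[of \<phi>], of W v] by blast
  let ?U = "h ` W" and ?\<mu> = "\<lambda>X. \<mu> {w \<in> W. h w \<in> X}"
  have "qpg_model ?U v' ?\<mu>"
    by (rule qpg_model_quotient[OF model v'])
  then have ne: "?U \<noteq> {}" and um: "uncertainty_measure ?U ?\<mu>" and k: "kps ?U ?\<mu>"
    by (auto simp: qpg_model_def qg_model_def)
  obtain M where M: "prob_space M" "space M = ?U" "sets M = Pow ?U"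
      "\<And>A B. A \<subseteq> ?U \<Longrightarrow> B \<subseteq> ?U \<Longrightarrow> measure M A \<le> measure M B \<longleftrightarrow> ?\<mu> A \<le> ?\<mu> B"
    using kps_representation[OF fin um k] by blast
  have "gaerdenfors_model ?U (\<lambda>_. M) v'"
    using M ne v' by (simp add: gaerdenfors_model_def gaerdenfors_frame_def)
  then have "qp_ext ?U (\<lambda>_. M) v' (qp_of_sif \<phi>) = ?U"
    using assms by (simp add: qp_valid_def qp_true_def)
  moreover obtain x where "x \<in> ?U" using ne by blast
  ultimately have "sif_holds (measure_le ?U v' (measure M)) \<phi>"
    using qp_ext_qp_of_sif[of x ?U "\<lambda>_. M"] by blast
  moreover have "measure_le ?U v' (measure M) = measure_le ?U v' ?\<mu>"
    using M(4) cpl_ext_subset[of v' ?U] v' by (intro ext) (simp add: measure_le_def)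
  ultimately have "sif_holds (measure_le W v \<mu>) \<phi>"
    using sif_holds_quotient[where v = v and W = W, OF v eq] by simp
  then show "qg_val W v \<mu> (delta_tr \<phi>) = 1"
    by (simp add: qg_val_delta_tr[OF qg])
qed

theorem theorem3p16:
  fixes \<phi> :: "'p::countable sif"
  shows "qp_valid TYPE('u::infinite) (qp_of_sif \<phi>) \<longleftrightarrow> qpg_valid TYPE('w::infinite) (delta_tr \<phi>)"
  using qp_valid_if_qpg_valid qpg_valid_if_qp_valid by blast

end
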